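(* Let $r \geq 2$ and let $F_r$ be a free group of rank $r$. Then the homomorphism $\phi : \mathrm{GAC}_r(F_r) \to \mathrm{AC}_r(F_r)$, $\alpha \mapsto \bar\alpha$, where $\bar\alpha$ is the restriction of the bijection $\alpha$ of $F_r^r$ to the invariant subset $\mathrm{NGen}_r(F_r)$, is an isomorphism.
   Context: For a group $G$ and $g, f \in G$ write $g^f = fgf^{-1}$. The elementary AC-moves on the set $G^r$ of $r$-tuples of elements of $G$ are the following bijections (each changes only the $i$-th component, $1 \le i \le r$): - $R_{ij}^{\pm 1}$ ($i \neq j$): replaces $u_i$ by $u_i u_j^{\pm 1}$; - $L_{ij}^{\pm 1}$ ($i \neq j$): replaces $u_i$ by $u_j^{\pm 1} u_i$; - $I_i$: replaces $u_i$ by $u_i^{-1}$; - $C_{i,w}$ ($w \in G$): replaces $u_i$ by $u_i^{w}$. $\mathrm{GAC}_r(G)$ is the subgroup of the symmetric group $\mathrm{Sym}(G^r)$ generated by all elementary AC-moves. $\mathrm{NGen}_r(G) \subseteq G^r$ is the set of all $r$-tuples whose normal closure is $G$; it is invariant under all elementary AC-moves. $\mathrm{AC}_r(G)$ is the subgroup of $\mathrm{Sym}(\mathrm{NGen}_r(G))$ generated by the restrictions of the elementary AC-moves to $\mathrm{NGen}_r(G)$. The Andrews-Curtis group of $F_r$ is $\mathrm{AC}(F_r) = \mathrm{AC}_r(F_r)$. Restriction to $\mathrm{NGen}_r(F_r)$ gives a surjective homomorphism $\phi : \mathrm{GAC}_r(F_r) \to \mathrm{AC}_r(F_r)$. *)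

theory Defs
  imports "HOL-Algebra.Algebra"
begin

section \<open>Free groups\<close>

definition sgn_pow :: "('a, 'm) monoid_scheme \<Rightarrow> 'a \<Rightarrow> bool \<Rightarrow> 'a"
  where "sgn_pow G x b = (if b then x else inv\<^bsub>G\<^esub> x)"

text \<open>A word over \<open>B\<close> is a list of letters \<open>(x, b)\<close> with \<open>x \<in> B\<close>, where \<open>(x, True)\<close> stands
  for \<open>x\<close> and \<open>(x, False)\<close> for the formal inverse of \<open>x\<close>.\<close>

definition word_value :: "('a, 'm) monoid_scheme \<Rightarrow> ('a \<times> bool) list \<Rightarrow> 'a"
  where "word_value G w = foldr (\<lambda>(x, b) y. sgn_pow G x b \<otimes>\<^bsub>G\<^esub> y) w \<one>\<^bsub>G\<^esub>"

definition reduced_words :: "'a set \<Rightarrow> ('a \<times> bool) list set"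
  where "reduced_words B =
    {w \<in> lists (B \<times> UNIV). successively (\<lambda>(x, b) (y, c). \<not> (x = y \<and> b \<noteq> c)) w}"

text \<open>\<open>B\<close> is a free basis if every element of \<open>G\<close> is the value of exactly one reduced word
  over \<open>B\<close>.\<close>

definition free_basis :: "('a, 'm) monoid_scheme \<Rightarrow> 'a set \<Rightarrow> bool"
  where "free_basis G B \<longleftrightarrow>
    B \<subseteq> carrier G \<and> bij_betw (word_value G) (reduced_words B) (carrier G)"

definition free_group_of_rank :: "('a, 'm) monoid_scheme \<Rightarrow> nat \<Rightarrow> bool"
  where "free_group_of_rank G r \<longleftrightarrow>
    group G \<and> (\<exists>B. finite B \<and> card B = r \<and> free_basis G B)"

section \<open>Tuples and elementary AC-moves\<close>

definition tuples :: "('a, 'm) monoid_scheme \<Rightarrow> nat \<Rightarrow> (nat \<Rightarrow> 'a) set"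
  where "tuples G r = {1..r} \<rightarrow>\<^sub>E carrier G"

definition normal_closure :: "('a, 'm) monoid_scheme \<Rightarrow> 'a set \<Rightarrow> 'a set"
  where "normal_closure G S = \<Inter>{N. N \<lhd> G \<and> S \<subseteq> N}"

definition NGen :: "('a, 'm) monoid_scheme \<Rightarrow> nat \<Rightarrow> (nat \<Rightarrow> 'a) set"
  where "NGen G r = {u \<in> tuples G r. normal_closure G (u ` {1..r}) = carrier G}"

text \<open>In the first two kinds of moves the Boolean is the sign of the exponent.\<close>

definition move_R :: "('a, 'm) monoid_scheme \<Rightarrow> nat \<Rightarrow> nat \<Rightarrow> nat \<Rightarrow> bool
    \<Rightarrow> (nat \<Rightarrow> 'a) \<Rightarrow> nat \<Rightarrow> 'a"
  where "move_R G r i j b = (\<lambda>u \<in> tuples G r. u(i := u i \<otimes>\<^bsub>G\<^esub> sgn_pow G (u j) b))"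

definition move_L :: "('a, 'm) monoid_scheme \<Rightarrow> nat \<Rightarrow> nat \<Rightarrow> nat \<Rightarrow> bool
    \<Rightarrow> (nat \<Rightarrow> 'a) \<Rightarrow> nat \<Rightarrow> 'a"
  where "move_L G r i j b = (\<lambda>u \<in> tuples G r. u(i := sgn_pow G (u j) b \<otimes>\<^bsub>G\<^esub> u i))"

definition move_I :: "('a, 'm) monoid_scheme \<Rightarrow> nat \<Rightarrow> nat \<Rightarrow> (nat \<Rightarrow> 'a) \<Rightarrow> nat \<Rightarrow> 'a"
  where "move_I G r i = (\<lambda>u \<in> tuples G r. u(i := inv\<^bsub>G\<^esub> (u i)))"

definition move_C :: "('a, 'm) monoid_scheme \<Rightarrow> nat \<Rightarrow> nat \<Rightarrow> 'a \<Rightarrow> (nat \<Rightarrow> 'a) \<Rightarrow> nat \<Rightarrow> 'a"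
  where "move_C G r i w =
    (\<lambda>u \<in> tuples G r. u(i := w \<otimes>\<^bsub>G\<^esub> u i \<otimes>\<^bsub>G\<^esub> inv\<^bsub>G\<^esub> w))"

definition elementary_moves :: "('a, 'm) monoid_scheme \<Rightarrow> nat \<Rightarrow> ((nat \<Rightarrow> 'a) \<Rightarrow> nat \<Rightarrow> 'a) set"
  where "elementary_moves G r =
      {move_R G r i j b | i j b. i \<in> {1..r} \<and> j \<in> {1..r} \<and> i \<noteq> j}
    \<union> {move_L G r i j b | i j b. i \<in> {1..r} \<and> j \<in> {1..r} \<and> i \<noteq> j}
    \<union> {move_I G r i | i. i \<in> {1..r}}
    \<union> {move_C G r i w | i w. i \<in> {1..r} \<and> w \<in> carrier G}"

section \<open>The groups and the restriction map\<close>

text \<open>\<^const>\<open>BijGroup\<close> is the symmetric group of a set. The library's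
  \<^const>\<open>subgroup_generated\<close> intersects the generators with the carrier; the lemmas at the
  end of this theory show that this discards nothing here.\<close>

definition GAC :: "nat \<Rightarrow> ('a, 'm) monoid_scheme \<Rightarrow> ((nat \<Rightarrow> 'a) \<Rightarrow> nat \<Rightarrow> 'a) monoid"
  where "GAC r G = subgroup_generated (BijGroup (tuples G r)) (elementary_moves G r)"

definition AC :: "nat \<Rightarrow> ('a, 'm) monoid_scheme \<Rightarrow> ((nat \<Rightarrow> 'a) \<Rightarrow> nat \<Rightarrow> 'a) monoid"
  where "AC r G = subgroup_generated (BijGroup (NGen G r))
    ((\<lambda>\<alpha>. restrict \<alpha> (NGen G r)) ` elementary_moves G r)"

definition AC_restriction :: "nat \<Rightarrow> ('a, 'm) monoid_scheme
    \<Rightarrow> ((nat \<Rightarrow> 'a) \<Rightarrow> nat \<Rightarrow> 'a) \<Rightarrow> (nat \<Rightarrow> 'a) \<Rightarrow> nat \<Rightarrow> 'a"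
  where "AC_restriction r G \<alpha> = restrict \<alpha> (NGen G r)"

section \<open>The moves are bijections preserving \<open>NGen\<close>\<close>

context group
begin

lemma tuples_upd:
  assumes "u \<in> tuples G r" "i \<in> {1..r}" "x \<in> carrier G"
  shows "u(i := x) \<in> tuples G r"
  using assms by (auto simp: tuples_def PiE_def extensional_def Pi_def)

lemma tuples_in: "u \<in> tuples G r \<Longrightarrow> i \<in> {1..r} \<Longrightarrow> u i \<in> carrier G"
  by (auto simp: tuples_def)

lemma sgn_pow_closed: "x \<in> carrier G \<Longrightarrow> sgn_pow G x b \<in> carrier G"
  by (simp add: sgn_pow_def)

lemma sgn_pow_cancel:
  assumes "x \<in> carrier G" "y \<in> carrier G"
  shows "y \<otimes> sgn_pow G x b \<otimes> sgn_pow G x (\<not> b) = y"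
    "sgn_pow G x (\<not> b) \<otimes> (sgn_pow G x b \<otimes> y) = y"
  using assms by (auto simp: sgn_pow_def m_assoc) (simp_all flip: m_assoc)

text \<open>Every move has an elementary move as its inverse.\<close>

lemma move_inverse:
  assumes "m \<in> elementary_moves G r"
  shows "\<exists>m' \<in> elementary_moves G r. \<forall>u \<in> tuples G r.
    m u \<in> tuples G r \<and> m' u \<in> tuples G r \<and> m' (m u) = u \<and> m (m' u) = u"
proof -
  note [simp] = tuples_upd tuples_in sgn_pow_closed sgn_pow_cancel
  consider (R) i j b where "m = move_R G r i j b" "i \<in> {1..r}" "j \<in> {1..r}" "i \<noteq> j"
    | (L) i j b where "m = move_L G r i j b" "i \<in> {1..r}" "j \<in> {1..r}" "i \<noteq> j"
    | (I) i where "m = move_I G r i" "i \<in> {1..r}"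
    | (C) i w where "m = move_C G r i w" "i \<in> {1..r}" "w \<in> carrier G"
    using assms unfolding elementary_moves_def by blast
  then show ?thesis
  proof cases
    case R
    have "move_R G r i j (\<not> b) \<in> elementary_moves G r"
      using R unfolding elementary_moves_def by blast
    moreover have "y \<otimes> sgn_pow G x (\<not> b) \<otimes> sgn_pow G x b = y"
      if "x \<in> carrier G" "y \<in> carrier G" for x y
      using sgn_pow_cancel(1)[OF that, of "\<not> b"] by simp
    ultimately show ?thesis using R by (intro bexI) (auto simp: move_R_def)
  next
    case L
    have "move_L G r i j (\<not> b) \<in> elementary_moves G r"
      using L unfolding elementary_moves_def by blast
    moreover have "sgn_pow G x b \<otimes> (sgn_pow G x (\<not> b) \<otimes> y) = y"
      if "x \<in> carrier G" "y \<in> carrier G" for x y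
      using sgn_pow_cancel(2)[OF that, of "\<not> b"] by simp
    ultimately show ?thesis using L by (intro bexI) (auto simp: move_L_def)
  next
    case I
    then show ?thesis using assms by (intro bexI[of _ m]) (auto simp: move_I_def)
  next
    case C
    have "move_C G r i (inv w) \<in> elementary_moves G r"
      using C unfolding elementary_moves_def by blast
    moreover have "inv w \<otimes> (w \<otimes> x \<otimes> inv w) \<otimes> w = x" "w \<otimes> (inv w \<otimes> x \<otimes> w) \<otimes> inv w = x"
      if "x \<in> carrier G" for x
      using that C by (simp_all add: m_assoc inv_solve_left inv_solve_right)
        (simp_all flip: m_assoc)
    ultimately show ?thesis using C by (intro bexI) (auto simp: move_C_def)
  qed
qed

lemma elementary_moves_subset: "elementary_moves G r \<subseteq> carrier (BijGroup (tuples G r))"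
proof
  fix m assume m: "m \<in> elementary_moves G r"
  obtain m' where "\<forall>u \<in> tuples G r.
      m u \<in> tuples G r \<and> m' u \<in> tuples G r \<and> m' (m u) = u \<and> m (m' u) = u"
    using move_inverse[OF m] by blast
  then have "bij_betw m (tuples G r) (tuples G r)"
    by (intro bij_betw_byWitness[where f' = m']) auto
  moreover have "m \<in> extensional (tuples G r)"
    using m by (auto simp: elementary_moves_def move_R_def move_L_def move_I_def move_C_def)
  ultimately show "m \<in> carrier (BijGroup (tuples G r))"
    by (simp add: BijGroup_def Bij_def)
qed

lemma move_in_normal:
  assumes "m \<in> elementary_moves G r" "u \<in> tuples G r" "N \<lhd> G" "u ` {1..r} \<subseteq> N"
  shows "m u ` {1..r} \<subseteq> N"
proof -
  interpret N: normal N G by fact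
  have "sgn_pow G x b \<in> N" if "x \<in> N" for x b
    using that by (simp add: sgn_pow_def)
  moreover have "u i \<in> N" if "i \<in> {1..r}" for i
    using assms(4) that by blast
  ultimately show ?thesis
    using assms(1,2)
    by (auto simp: elementary_moves_def move_R_def move_L_def move_I_def move_C_def
        N.inv_op_closed2)
qed

lemma move_in_NGen:
  assumes m: "m \<in> elementary_moves G r" and u: "u \<in> NGen G r"
  shows "m u \<in> NGen G r"
proof -
  obtain m' where m': "m' \<in> elementary_moves G r" and
    *: "\<forall>u \<in> tuples G r. m u \<in> tuples G r \<and> m' u \<in> tuples G r \<and> m' (m u) = u"
    using move_inverse[OF m] by blast
  have ut: "u \<in> tuples G r" using u by (simp add: NGen_def)
  have "m u ` {1..r} \<subseteq> N \<longleftrightarrow> u ` {1..r} \<subseteq> N" if "N \<lhd> G" for N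
    using move_in_normal[OF m ut that] move_in_normal[OF m', of "m u", OF _ that] * ut
    by auto
  then have "normal_closure G (m u ` {1..r}) = normal_closure G (u ` {1..r})"
    unfolding normal_closure_def by (metis (no_types, lifting))
  then show ?thesis using u * ut by (simp add: NGen_def)
qed

lemma restricted_moves_subset:
  "(\<lambda>\<alpha>. restrict \<alpha> (NGen G r)) ` elementary_moves G r \<subseteq> carrier (BijGroup (NGen G r))"
proof clarify
  fix m assume m: "m \<in> elementary_moves G r"
  obtain m' where "m' \<in> elementary_moves G r" and
    "\<forall>u \<in> tuples G r. m' (m u) = u \<and> m (m' u) = u"
    using move_inverse[OF m] by blast
  then have "bij_betw m (NGen G r) (NGen G r)"
    using move_in_NGen m
    by (intro bij_betw_byWitness[where f' = m']) (auto simp: NGen_def)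
  then show "restrict m (NGen G r) \<in> carrier (BijGroup (NGen G r))"
    by (simp add: BijGroup_def Bij_def)
qed

end

end

(* Only injectivity is at stake. Each component of an element of GAC_r(F) is given by a mixed word,
   i.e. an element of the free product of F with the free group on the variables u_1, ..., u_r.
   So it suffices that a mixed word which is trivial on NGen_r(F) is trivial on all tuples. After
   cancellation, evaluate a nonconstant reduced mixed word at u_i = g_i x_i g_i^-1, where the x_i
   are a basis; this tuple lies in NGen_r(F). Take g_i = x_1^N x_2 t_i with N at least the length of
   all constants involved. By ping-pong, u_i^{+-1} sends everything outside the set of elements with
   prefix g_i x_i^{-+1} into the set of elements with prefix g_i x_i^{+-1}, and a constant
   between two variables never leads into the excluded set, because the word is reduced. Hence the
   value is not 1. *)

theory Submission
  imports Defs "HOL-Library.Sublist"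
begin

section \<open>Words in a free group\<close>

declare in_listsD [rule del] in_listsI [rule del]

lemma (in group) word_value_Nil [simp]: "word_value G [] = \<one>"
  by (simp add: word_value_def)

lemma (in group) word_value_Cons [simp]:
  "word_value G ((x, b) # w) = sgn_pow G x b \<otimes> word_value G w"
  by (simp add: word_value_def)

lemma (in group) sgn_pow_not: "x \<in> carrier G \<Longrightarrow> sgn_pow G x (\<not> b) = inv (sgn_pow G x b)"
  by (simp add: sgn_pow_def)

lemma (in group) word_value_closed:
  "w \<in> lists (carrier G \<times> UNIV) \<Longrightarrow> word_value G w \<in> carrier G"
  by (induction w) (auto simp: sgn_pow_closed)

lemma (in group) word_value_append:
  assumes "v \<in> lists (carrier G \<times> UNIV)" "w \<in> lists (carrier G \<times> UNIV)"
  shows "word_value G (v @ w) = word_value G v \<otimes> word_value G w"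
  using assms by (induction v) (auto simp: sgn_pow_closed word_value_closed m_assoc)

lemma reduced_words_Cons:
  "(x, b) # w \<in> reduced_words B \<longleftrightarrow>
    x \<in> B \<and> w \<in> reduced_words B \<and> (w = [] \<or> hd w \<noteq> (x, \<not> b))"
  by (cases w) (auto simp: reduced_words_def)

lemma reduced_words_append:
  "v @ w \<in> reduced_words B \<longleftrightarrow> v \<in> reduced_words B \<and> w \<in> reduced_words B \<and>
    (v = [] \<or> w = [] \<or> \<not> (fst (last v) = fst (hd w) \<and> snd (last v) \<noteq> snd (hd w)))"
  by (auto simp: reduced_words_def successively_append_iff split_beta)

text \<open>The first letter different from \<open>x\<close> stands at position \<open>m\<close> on
  one side and at position \<open>n\<close> on the other.\<close>

lemma replicate_append_Cons_eqD:
  assumes "replicate m x @ y # v = replicate n x @ y # w" "x \<noteq> y"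
  shows "m = n \<and> v = w"
  using assms
proof (induction m arbitrary: n)
  case 0
  then show ?case by (cases n) auto
next
  case (Suc m)
  then show ?case by (cases n) auto
qed

locale free_group = group F for F :: "('a, 'm) monoid_scheme" (structure) +
  fixes B :: "'a set"
  assumes basis: "free_basis F B"
begin

lemma basis_closed: "x \<in> B \<Longrightarrow> x \<in> carrier F"
  using basis by (auto simp: free_basis_def)

lemma lists_closed: "w \<in> lists (B \<times> UNIV) \<Longrightarrow> w \<in> lists (carrier F \<times> UNIV)"
  using basis_closed by (auto simp: lists_eq_set)

lemma reduced_closed: "w \<in> reduced_words B \<Longrightarrow> w \<in> lists (carrier F \<times> UNIV)"
  using lists_closed by (auto simp: reduced_words_def)

lemma reduced_value_closed [simp]: "w \<in> reduced_words B \<Longrightarrow> word_value F w \<in> carrier F"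
  by (simp add: reduced_closed word_value_closed)

lemma reduced_value_append:
  "v \<in> reduced_words B \<Longrightarrow> w \<in> reduced_words B
    \<Longrightarrow> word_value F (v @ w) = word_value F v \<otimes> word_value F w"
  by (simp add: reduced_closed word_value_append)

section \<open>Normal forms and left multiplication\<close>

definition normal_form :: "'a \<Rightarrow> ('a \<times> bool) list"
  where "normal_form = the_inv_into (reduced_words B) (word_value F)"

lemma normal_form_reduced: "f \<in> carrier F \<Longrightarrow> normal_form f \<in> reduced_words B"
  and normal_form_value: "f \<in> carrier F \<Longrightarrow> word_value F (normal_form f) = f"
  and normal_form_eq: "w \<in> reduced_words B \<Longrightarrow> normal_form (word_value F w) = w"
  using basis
  by (auto simp: normal_form_def free_basis_def bij_betw_def
      intro: the_inv_into_into f_the_inv_into_f the_inv_into_f_f)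

lemma normal_form_mult_letter:
  assumes "x \<in> B" "w \<in> reduced_words B"
  shows "normal_form (sgn_pow F x b \<otimes> word_value F w) =
    (if w \<noteq> [] \<and> hd w = (x, \<not> b) then tl w else (x, b) # w)"
proof (cases "w \<noteq> [] \<and> hd w = (x, \<not> b)")
  case True
  then obtain v where v: "w = (x, \<not> b) # v" by (cases w) auto
  then have "v \<in> reduced_words B" using assms by (simp add: reduced_words_Cons)
  then show ?thesis
    using v assms sgn_pow_cancel(2)[of x "word_value F v" "\<not> b"]
    by (simp add: basis_closed normal_form_eq)
next
  case False
  then have "(x, b) # w \<in> reduced_words B" using assms by (auto simp: reduced_words_Cons)
  from normal_form_eq[OF this] False show ?thesis by auto
qed

text \<open>The letters of \<open>v\<close> act one after the other, the last one first. Each is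
  prepended to \<open>p\<close>, or cancels the first letter of \<open>p\<close>, or, when
  \<open>p\<close> is empty, removes one more letter of \<open>w\<close>.\<close>

lemma normal_form_mult:
  assumes "v \<in> lists (B \<times> UNIV)" "w \<in> reduced_words B"
  shows "\<exists>p q. length p \<le> length v \<and> q \<le> length v \<and>
    normal_form (word_value F v \<otimes> word_value F w) = p @ drop q w"
  using assms(1)
proof (induction v rule: list.induct)
  case Nil
  then show ?case using assms(2) by (intro exI[of _ "[]"] exI[of _ 0]) (simp add: normal_form_eq)
next
  case (Cons l v)
  obtain x b where l: "l = (x, b)" by (cases l)
  have x: "x \<in> B" and v: "v \<in> lists (B \<times> UNIV)" using Cons.prems l by auto
  have vc: "word_value F v \<in> carrier F" using v by (simp add: lists_closed word_value_closed)
  have xc: "sgn_pow F x b \<in> carrier F" using x by (simp add: basis_closed sgn_pow_closed)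
  obtain p q where pq: "length p \<le> length v" "q \<le> length v"
    and nf: "normal_form (word_value F v \<otimes> word_value F w) = p @ drop q w"
    using Cons.IH[OF v] by blast
  have f: "word_value F v \<otimes> word_value F w \<in> carrier F" using vc assms(2) by simp
  have red: "p @ drop q w \<in> reduced_words B" using normal_form_reduced[OF f] nf by simp
  have "word_value F (l # v) \<otimes> word_value F w = sgn_pow F x b \<otimes> word_value F (p @ drop q w)"
    using l xc vc assms(2) normal_form_value[OF f] nf by (simp add: m_assoc)
  then have eq: "normal_form (word_value F (l # v) \<otimes> word_value F w) =
    (if p @ drop q w \<noteq> [] \<and> hd (p @ drop q w) = (x, \<not> b) then tl (p @ drop q w)
     else (x, b) # p @ drop q w)"
    using normal_form_mult_letter[OF x red] by simp
  show ?case
  proof (cases "p @ drop q w \<noteq> [] \<and> hd (p @ drop q w) = (x, \<not> b)")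
    case False
    then show ?thesis using eq pq by (intro exI[of _ "(x, b) # p"] exI[of _ q]) auto
  next
    case True
    show ?thesis
    proof (cases p)
      case Nil
      then show ?thesis using eq pq True
        by (intro exI[of _ "[]"] exI[of _ "Suc q"]) (simp add: drop_Suc tl_drop)
    next
      case (Cons y p')
      then show ?thesis using eq pq True by (intro exI[of _ p'] exI[of _ q]) auto
    qed
  qed
qed

section \<open>Cones and the ping-pong step\<close>

text \<open>For a nonempty reduced \<open>z\<close>, this is the half-tree of the Cayley tree of
  \<open>F\<close> beyond the last edge of the path from \<open>\<one>\<close> labelled
  \<open>z\<close>.\<close>

definition cone :: "('a \<times> bool) list \<Rightarrow> 'a set"
  where "cone z = {f \<in> carrier F. prefix z (normal_form f)}"

text \<open>Let \<open>h\<close> be the value of \<open>g\<close> and \<open>v\<close> the normal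
  form of \<open>inv h \<otimes> f\<close>. If \<open>v\<close> began with
  \<open>(x, \<not> b)\<close>, then \<open>g @ v\<close> would be reduced, because \<open>g\<close>
  does not end in \<open>x\<close>, and \<open>f\<close> would lie in the excluded cone. So
  \<open>g @ (x, b) # v\<close> is reduced, and it spells the product.\<close>

lemma conjugate_maps_into_cone:
  assumes g: "g \<in> reduced_words B" "g = [] \<or> fst (last g) \<noteq> x" and x: "x \<in> B"
    and f: "f \<in> carrier F" "f \<notin> cone (g @ [(x, \<not> b)])"
  shows "sgn_pow F (word_value F g \<otimes> x \<otimes> inv word_value F g) b \<otimes> f \<in> cone (g @ [(x, b)])"
proof -
  define h where "h = word_value F g"
  have h: "h \<in> carrier F" using g by (simp add: h_def)
  have xc: "x \<in> carrier F" using x by (rule basis_closed)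
  define v where "v = normal_form (inv h \<otimes> f)"
  have vr: "v \<in> reduced_words B" using f h by (simp add: v_def normal_form_reduced)
  have vv: "word_value F v = inv h \<otimes> f" using f h by (simp add: v_def normal_form_value)
  have hd: "v = [] \<or> hd v \<noteq> (x, \<not> b)"
  proof (rule ccontr)
    assume "\<not> ?thesis"
    then obtain v' where v': "v = (x, \<not> b) # v'" by (cases v) auto
    have "g @ v \<in> reduced_words B" using g vr v' by (auto simp: reduced_words_append)
    moreover have "word_value F (g @ v) = f"
      using g vr vv h f by (simp add: reduced_value_append flip: h_def m_assoc)
    ultimately have "normal_form f = g @ v" using normal_form_eq by metis
    then show False using f v' by (simp add: cone_def)
  qed
  have red: "g @ (x, b) # v \<in> reduced_words B"
    using g vr hd x by (auto simp: reduced_words_append reduced_words_Cons)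
  have "sgn_pow F (h \<otimes> x \<otimes> inv h) b = h \<otimes> sgn_pow F x b \<otimes> inv h"
    using h xc by (simp add: sgn_pow_def inv_mult_group m_assoc)
  moreover have "word_value F (g @ (x, b) # v) = h \<otimes> (sgn_pow F x b \<otimes> (inv h \<otimes> f))"
    using g red vv by (simp add: reduced_words_append reduced_value_append flip: h_def)
  ultimately have "sgn_pow F (h \<otimes> x \<otimes> inv h) b \<otimes> f = word_value F (g @ (x, b) # v)"
    using h xc f by (simp add: m_assoc sgn_pow_closed)
  then show ?thesis using red normal_form_eq[OF red] by (simp add: cone_def flip: h_def)
qed

text \<open>The block \<open>replicate N (a, True)\<close> is too long to be cancelled by \<open>v\<close>, and the \<open>(b, True)\<close>
  after it then forces its length to be preserved.\<close>

lemma cone_translate_disjoint: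
  assumes ab: "a \<noteq> b"
    and c: "v \<in> lists (B \<times> UNIV)" "length v \<le> N"
    and f: "f \<in> cone (replicate N (a, True) @ (b, True) # s)"
    and cf: "word_value F v \<otimes> f \<in> cone (replicate N (a, True) @ (b, True) # t)"
  shows "word_value F v = \<one> \<and> (prefix s t \<or> prefix t s)"
proof -
  let ?A = "(a, True)" and ?B = "(b, True)"
  obtain h where h: "normal_form f = replicate N ?A @ ?B # s @ h" and fc: "f \<in> carrier F"
    using f by (auto simp: cone_def prefix_def)
  obtain h' where h': "normal_form (word_value F v \<otimes> f) = replicate N ?A @ ?B # t @ h'"
    using cf by (auto simp: cone_def prefix_def)
  have vc: "word_value F v \<in> carrier F" using c by (simp add: lists_closed word_value_closed)
  obtain p q where pq: "length p \<le> length v" "q \<le> length v"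
    and nf: "normal_form (word_value F v \<otimes> f) = p @ drop q (normal_form f)"
    using normal_form_mult[OF c(1) normal_form_reduced[OF fc]] normal_form_value[OF fc] by auto
  \<comment> \<open>Since \<open>q \<le> N\<close>, only letters of the block are dropped. Since
    \<open>length p \<le> N\<close>, all of \<open>p\<close> lies inside the block on the right-hand
    side, so it consists of \<open>?A\<close> too.\<close>
  have eq: "p @ replicate (N - q) ?A @ ?B # s @ h = replicate N ?A @ ?B # t @ h'"
    using nf h h' pq c by simp
  have "p = take (length p) (replicate N ?A @ ?B # t @ h')"
    using eq by (metis append_eq_conv_conj)
  then have p: "p = replicate (length p) ?A" using pq c by (simp add: min_def)
  have "replicate (length p + (N - q)) ?A @ ?B # s @ h = replicate N ?A @ ?B # t @ h'"
    using eq p by (metis append_assoc replicate_add)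
  from replicate_append_Cons_eqD[OF this]
  have "length p + (N - q) = N" and st: "s @ h = t @ h'"
    using ab by simp_all
  then have "length p = q" using pq c by linarith
  \<comment> \<open>By \<open>st\<close> the two normal forms coincide letter for letter, so
    multiplication by the value of \<open>v\<close> fixes \<open>f\<close>.\<close>
  then have "normal_form (word_value F v \<otimes> f) = normal_form f"
    using h' h st by simp
  then have "word_value F (normal_form (word_value F v \<otimes> f)) = word_value F (normal_form f)"
    by simp
  then have "word_value F v = \<one>" using vc fc by (simp add: normal_form_value)
  then show ?thesis using st by (metis prefixI prefix_same_cases)
qed

text \<open>A normal form is at most as long as any word with the same value. This starts the
  ping-pong, at the constant after the last variable.\<close>

lemma short_not_in_cone:
  assumes "v \<in> lists (B \<times> UNIV)" "length v < length z"
  shows "word_value F v \<notin> cone z"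
proof
  assume "word_value F v \<in> cone z"
  then have z: "prefix z (normal_form (word_value F v))" and v: "word_value F v \<in> carrier F"
    by (simp_all add: cone_def)
  have "[] \<in> reduced_words B" by (simp add: reduced_words_def)
  from normal_form_mult[OF assms(1) this] have "length (normal_form (word_value F v)) \<le> length v"
    using v by auto
  then show False using prefix_length_le[OF z] assms(2) by simp
qed

text \<open>A word shorter than \<open>z\<close> cannot cancel all of the prefix \<open>z\<close>.
  This ends the ping-pong, at the constant before the first variable.\<close>

lemma translate_cone_ne_one:
  assumes "v \<in> lists (B \<times> UNIV)" "length v < length z" "f \<in> cone z"
  shows "word_value F v \<otimes> f \<noteq> \<one>"
proof
  assume eq: "word_value F v \<otimes> f = \<one>"
  have fc: "f \<in> carrier F" and z: "prefix z (normal_form f)" using assms by (auto simp: cone_def)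
  obtain p q where "q \<le> length v" "normal_form \<one> = p @ drop q (normal_form f)"
    using normal_form_mult[OF assms(1) normal_form_reduced[OF fc]] normal_form_value[OF fc] eq
    by auto
  moreover have "normal_form \<one> = []"
    using normal_form_eq[of "[]"] by (simp add: reduced_words_def)
  ultimately show False using prefix_length_le[OF z] assms(2) by auto
qed

end

section \<open>Mixed words\<close>

text \<open>A triple \<open>(c, i, e)\<close> stands for \<open>c\<close> times the variable \<open>u i\<close> with exponent sign \<open>e\<close>, and
  \<open>d\<close> is the constant after the last variable.\<close>

fun mixed_value ::
  "('a, 'm) monoid_scheme \<Rightarrow> ('a \<times> nat \<times> bool) list \<Rightarrow> 'a \<Rightarrow> (nat \<Rightarrow> 'a) \<Rightarrow> 'a"
  where
    "mixed_value G [] d u = d"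
  | "mixed_value G ((c, i, e) # ws) d u =
      c \<otimes>\<^bsub>G\<^esub> (sgn_pow G (u i) e \<otimes>\<^bsub>G\<^esub> mixed_value G ws d u)"

text \<open>The constant between two consecutive variables is the \<open>c'\<close> of the second
  triple. Followed by a last constant, these lists are the normal forms of the free product of
  \<open>G\<close> with a free group of rank \<open>r\<close>.\<close>

definition reduced_mixed :: "('a, 'm) monoid_scheme \<Rightarrow> nat \<Rightarrow> ('a \<times> nat \<times> bool) list set"
  where "reduced_mixed G r = {ws \<in> lists (carrier G \<times> {1..r} \<times> UNIV).
    successively (\<lambda>(c, i, e) (c', i', e'). \<not> (c' = \<one>\<^bsub>G\<^esub> \<and> i' = i \<and> e' \<noteq> e)) ws}"

text \<open>Elements of the free product appear only through the functions they induce, which are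
  left unconstrained outside \<open>tuples G r\<close>.\<close>

definition word_maps :: "('a, 'm) monoid_scheme \<Rightarrow> nat \<Rightarrow> ((nat \<Rightarrow> 'a) \<Rightarrow> 'a) set"
  where "word_maps G r = {f. \<exists>ws \<in> reduced_mixed G r. \<exists>d \<in> carrier G.
    \<forall>u \<in> tuples G r. f u = mixed_value G ws d u}"

lemma reduced_mixed_Cons:
  "(c, i, e) # ws \<in> reduced_mixed G r \<longleftrightarrow> c \<in> carrier G \<and> i \<in> {1..r} \<and>
    ws \<in> reduced_mixed G r \<and> (ws = [] \<or> hd ws \<noteq> (\<one>\<^bsub>G\<^esub>, i, \<not> e))"
  by (cases ws) (auto simp: reduced_mixed_def)

section \<open>Closure properties of word maps\<close>

context group
begin

lemma mixed_value_closed: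
  assumes "ws \<in> reduced_mixed G r" "d \<in> carrier G" "u \<in> tuples G r"
  shows "mixed_value G ws d u \<in> carrier G"
  using assms
proof (induction ws)
  case (Cons w ws)
  then show ?case
    by (cases w) (simp add: reduced_mixed_Cons sgn_pow_closed tuples_in)
qed simp

lemma word_map_closed: "f \<in> word_maps G r \<Longrightarrow> u \<in> tuples G r \<Longrightarrow> f u \<in> carrier G"
  by (auto simp: word_maps_def mixed_value_closed)

lemma word_maps_cong:
  "f \<in> word_maps G r \<Longrightarrow> (\<And>u. u \<in> tuples G r \<Longrightarrow> f u = g u) \<Longrightarrow> g \<in> word_maps G r"
  by (auto simp: word_maps_def)

lemma word_maps_const: "d \<in> carrier G \<Longrightarrow> (\<lambda>u. d) \<in> word_maps G r"
  unfolding word_maps_def by (auto intro!: bexI[of _ "[]"] bexI[of _ d] simp: reduced_mixed_def)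

lemma word_maps_const_mult:
  assumes f: "f \<in> word_maps G r" and c: "c \<in> carrier G"
  shows "(\<lambda>u. c \<otimes> f u) \<in> word_maps G r"
proof -
  obtain ws d where ws: "ws \<in> reduced_mixed G r" and d: "d \<in> carrier G"
    and eq: "\<And>u. u \<in> tuples G r \<Longrightarrow> f u = mixed_value G ws d u"
    using f by (auto simp: word_maps_def)
  show ?thesis
  proof (cases ws)
    case Nil
    then show ?thesis using word_maps_cong[OF word_maps_const[of "c \<otimes> d" r]] eq c d by simp
  next
    case (Cons w ws')
    obtain c' i e where w: "w = (c', i, e)" by (cases w)
    have "(c \<otimes> c', i, e) # ws' \<in> reduced_mixed G r"
      using ws Cons w c by (simp add: reduced_mixed_Cons)
    moreover have "c \<otimes> f u = mixed_value G ((c \<otimes> c', i, e) # ws') d u" if u: "u \<in> tuples G r" for u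
    proof -
      have ws': "ws' \<in> reduced_mixed G r" and i: "i \<in> {1..r}" and "c' \<in> carrier G"
        using ws Cons w by (auto simp: reduced_mixed_Cons)
      then show ?thesis
        using eq[OF u] Cons w c mixed_value_closed[OF ws' d u] sgn_pow_closed[OF tuples_in[OF u i]]
        by (simp add: m_assoc)
    qed
    ultimately show ?thesis using d unfolding word_maps_def by blast
  qed
qed

text \<open>The variable may meet its own inverse at the head of \<open>ws\<close>, with constant
  \<open>\<one>\<close> in between. Then the first triple cancels, and the remaining list is again
  reduced.\<close>

lemma word_maps_var_mult:
  assumes f: "f \<in> word_maps G r" and i: "i \<in> {1..r}"
  shows "(\<lambda>u. sgn_pow G (u i) e \<otimes> f u) \<in> word_maps G r"
proof -
  obtain ws d where ws: "ws \<in> reduced_mixed G r" and d: "d \<in> carrier G"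
    and eq: "\<And>u. u \<in> tuples G r \<Longrightarrow> f u = mixed_value G ws d u"
    using f by (auto simp: word_maps_def)
  show ?thesis
  proof (cases "ws = [] \<or> hd ws \<noteq> (\<one>, i, \<not> e)")
    case True
    then have "(\<one>, i, e) # ws \<in> reduced_mixed G r" using ws i by (simp add: reduced_mixed_Cons)
    moreover have "sgn_pow G (u i) e \<otimes> f u = mixed_value G ((\<one>, i, e) # ws) d u"
      if "u \<in> tuples G r" for u
      using ws d that i by (simp add: eq sgn_pow_closed tuples_in mixed_value_closed)
    ultimately show ?thesis using d unfolding word_maps_def by blast
  next
    case False
    then obtain ws' where ws': "ws = (\<one>, i, \<not> e) # ws'" by (cases ws) auto
    then have red: "ws' \<in> reduced_mixed G r" using ws by (simp add: reduced_mixed_Cons)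
    have "sgn_pow G (u i) e \<otimes> f u = mixed_value G ws' d u" if u: "u \<in> tuples G r" for u
      using sgn_pow_cancel(2)[of "u i" "mixed_value G ws' d u" "\<not> e"] mixed_value_closed[OF red d u]
        tuples_in[OF u i] sgn_pow_closed[OF tuples_in[OF u i]] eq[OF u]
      by (simp add: ws')
    then show ?thesis using d red unfolding word_maps_def by blast
  qed
qed

text \<open>A mixed word arises from its last constant by multiplying alternately by variables and
  constants from the left. The case \<open>cong\<close> covers functions that agree with such a word
  only on \<open>tuples G r\<close>.\<close>

lemma word_maps_mixed_induct [consumes 1, case_names cong const const_mult var_mult]:
  assumes "f \<in> word_maps G r"
    and cong: "\<And>f g. P f \<Longrightarrow> f \<in> word_maps G r \<Longrightarrow> (\<And>u. u \<in> tuples G r \<Longrightarrow> f u = g u) \<Longrightarrow> P g"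
    and const: "\<And>d. d \<in> carrier G \<Longrightarrow> P (\<lambda>u. d)"
    and const_mult: "\<And>c f. c \<in> carrier G \<Longrightarrow> f \<in> word_maps G r \<Longrightarrow> P f \<Longrightarrow> P (\<lambda>u. c \<otimes> f u)"
    and var_mult: "\<And>i e f. i \<in> {1..r} \<Longrightarrow> f \<in> word_maps G r \<Longrightarrow> P f
      \<Longrightarrow> P (\<lambda>u. sgn_pow G (u i) e \<otimes> f u)"
  shows "P f"
proof -
  obtain ws d where ws: "ws \<in> reduced_mixed G r" and d: "d \<in> carrier G"
    and eq: "\<And>u. u \<in> tuples G r \<Longrightarrow> f u = mixed_value G ws d u"
    using assms(1) by (auto simp: word_maps_def)
  have "P (mixed_value G ws d) \<and> mixed_value G ws d \<in> word_maps G r"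
    using ws
  proof (induction ws)
    case Nil
    then show ?case using const[OF d] word_maps_const[OF d] by (simp add: fun_eq_iff[symmetric])
  next
    case (Cons w ws)
    obtain c i e where w: "w = (c, i, e)" by (cases w)
    have c: "c \<in> carrier G" and i: "i \<in> {1..r}" and ws: "ws \<in> reduced_mixed G r"
      using Cons.prems w by (auto simp: reduced_mixed_Cons)
    have "mixed_value G (w # ws) d = (\<lambda>u. c \<otimes> (sgn_pow G (u i) e \<otimes> mixed_value G ws d u))"
      by (simp add: w fun_eq_iff)
    then show ?case
      using Cons.IH[OF ws] c i const_mult var_mult word_maps_const_mult word_maps_var_mult
      by simp
  qed
  then show ?thesis using cong eq by metis
qed

text \<open>Induction on the left factor: cancellation where the two words meet is already dealt
  with by left multiplication by a single variable.\<close>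

lemma word_maps_mult:
  assumes "f \<in> word_maps G r" "g \<in> word_maps G r"
  shows "(\<lambda>u. f u \<otimes> g u) \<in> word_maps G r"
  using assms(1)
proof (induction rule: word_maps_mixed_induct)
  case (cong f f')
  then show ?case by (elim word_maps_cong) simp
next
  case (const d)
  then show ?case using assms(2) by (intro word_maps_const_mult)
next
  case (const_mult c f)
  then show ?case
    using word_maps_cong[OF word_maps_const_mult[OF const_mult(3,1)]] assms(2)
    by (simp add: m_assoc word_map_closed)
next
  case (var_mult i e f)
  then show ?case
    using word_maps_cong[OF word_maps_var_mult[OF var_mult(3,1), of e]] assms(2)
    by (simp add: m_assoc word_map_closed sgn_pow_closed tuples_in)
qed

lemma word_maps_var: "i \<in> {1..r} \<Longrightarrow> (\<lambda>u. sgn_pow G (u i) e) \<in> word_maps G r"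
  using word_maps_cong[OF word_maps_var_mult[OF word_maps_const[OF one_closed], of i r e]]
  by (simp add: sgn_pow_closed tuples_in)

text \<open>Inversion moves the factors split off on the left to the right-hand end, so the
  induction rests on products of word maps.\<close>

lemma word_maps_inv:
  assumes "f \<in> word_maps G r"
  shows "(\<lambda>u. inv (f u)) \<in> word_maps G r"
  using assms
proof (induction rule: word_maps_mixed_induct)
  case (cong f g)
  then show ?case by (elim word_maps_cong) simp
next
  case (const d)
  then show ?case by (intro word_maps_const) simp
next
  case (const_mult c f)
  then show ?case
    using word_maps_cong[OF word_maps_mult[OF const_mult(3) word_maps_const[of "inv c"]]]
    by (simp add: inv_mult_group word_map_closed)
next
  case (var_mult i e f)
  then show ?case
    using word_maps_cong[OF word_maps_mult[OF var_mult(3) word_maps_var[of i r "\<not> e"]]]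
    by (simp add: inv_mult_group word_map_closed sgn_pow_closed tuples_in sgn_pow_not)
qed

end

section \<open>Separating mixed words by normally generating tuples\<close>

locale free_group_rank = free_group F B for F :: "('a, 'm) monoid_scheme" (structure) and B +
  fixes r :: nat and x :: "nat \<Rightarrow> 'a"
  assumes rank: "r \<ge> 2" and x: "bij_betw x {1..r} B"
begin

lemma x_basis: "i \<in> {1..r} \<Longrightarrow> x i \<in> B"
  using x by (auto simp: bij_betw_def)

lemma x_eq_iff: "i \<in> {1..r} \<Longrightarrow> j \<in> {1..r} \<Longrightarrow> x i = x j \<longleftrightarrow> i = j"
  using inj_on_eq_iff[OF bij_betw_imp_inj_on[OF x]] by blast

text \<open>Chosen so that \<open>tail_word i\<close> does not end in \<open>x i\<close> and the words
  \<open>tail_word i @ [(x i, e)]\<close> form a prefix code.\<close>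

definition tail_word :: "nat \<Rightarrow> ('a \<times> bool) list"
  where "tail_word i = (if i = 1 then [(x 2, True)] else if i = 2 then [(x 1, True)] else [])"

definition conjugator :: "nat \<Rightarrow> nat \<Rightarrow> ('a \<times> bool) list"
  where "conjugator N i = replicate N (x 1, True) @ (x 2, True) # tail_word i"

definition conjugate_tuple :: "nat \<Rightarrow> nat \<Rightarrow> 'a"
  where "conjugate_tuple N = (\<lambda>i \<in> {1..r}.
    word_value F (conjugator N i) \<otimes> x i \<otimes> inv word_value F (conjugator N i))"

text \<open>The first letters are \<open>x 2\<close> for \<open>i = 1\<close>, \<open>x 1\<close>
  for \<open>i = 2\<close> and \<open>x i\<close> otherwise, all distinct. So the first letter
  determines the index, and the last letter then gives the sign.\<close>

lemma tail_word_prefix_code: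
  assumes "i \<in> {1..r}" "j \<in> {1..r}" "prefix (tail_word i @ [(x i, e)]) (tail_word j @ [(x j, e')])"
  shows "i = j \<and> e = e'"
  using assms rank x_eq_iff[of 1 2] x_eq_iff[of i 1] x_eq_iff[of j 1] x_eq_iff[of i 2]
    x_eq_iff[of j 2] x_eq_iff[of i j]
  by (auto simp: tail_word_def split: if_splits)

text \<open>All letters are positive, so nothing cancels. The last letter is \<open>x 1\<close> for
  \<open>i = 2\<close> and \<open>x 2\<close> for every other \<open>i\<close>.\<close>

lemma conjugator_reduced:
  assumes "i \<in> {1..r}"
  shows "conjugator N i \<in> reduced_words B" "fst (last (conjugator N i)) \<noteq> x i"
proof -
  have B: "x 1 \<in> B" "x 2 \<in> B" and ne: "x 1 \<noteq> x 2"
    using x_basis[of 1] x_basis[of 2] x_eq_iff[of 1 2] rank by auto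
  have nil: "[] \<in> reduced_words B" by (simp add: reduced_words_def)
  have "replicate N (x 1, True) \<in> reduced_words B"
  proof (induction N)
    case (Suc N)
    then show ?case using B by (cases N) (auto simp: reduced_words_Cons)
  qed (simp add: nil)
  then show "conjugator N i \<in> reduced_words B"
    using B ne nil
    by (cases "N = 0")
      (auto simp: conjugator_def tail_word_def reduced_words_append reduced_words_Cons)
  show "fst (last (conjugator N i)) \<noteq> x i"
    using assms ne x_eq_iff[of i 2] rank by (auto simp: conjugator_def tail_word_def)
qed

lemma normal_closure_basis:
  assumes N: "N \<lhd> F" and sub: "B \<subseteq> N"
  shows "N = carrier F"
proof
  interpret N: normal N F by (rule N)
  show "N \<subseteq> carrier F" by (rule N.subset)
  have "word_value F w \<in> N" if "w \<in> lists (B \<times> UNIV)" for w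
    using that
  proof (induction w rule: list.induct)
    case (Cons l w)
    then show ?case using sub by (cases l) (auto simp: sgn_pow_def)
  qed simp
  then have "word_value F (normal_form f) \<in> N" if "f \<in> carrier F" for f
    using normal_form_reduced[OF that] by (simp add: reduced_words_def)
  then show "carrier F \<subseteq> N" by (auto simp: normal_form_value)
qed

text \<open>A normal subgroup that contains a conjugate of each basis element contains the basis
  itself.\<close>

lemma conjugate_tuple_NGen: "conjugate_tuple N \<in> NGen F r"
proof -
  let ?u = "conjugate_tuple N"
  have g: "word_value F (conjugator N i) \<in> carrier F" if "i \<in> {1..r}" for i
    using conjugator_reduced[OF that] by simp
  have "?u \<in> tuples F r"
    using g x_basis basis_closed by (auto simp: tuples_def conjugate_tuple_def)
  moreover have "M = carrier F" if M: "M \<lhd> F" and sub: "?u ` {1..r} \<subseteq> M" for M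
  proof (rule normal_closure_basis[OF M])
    interpret M: normal M F by (rule M)
    have "x i \<in> M" if i: "i \<in> {1..r}" for i
    proof -
      let ?g = "word_value F (conjugator N i)"
      have xi: "x i \<in> carrier F" using i x_basis basis_closed by simp
      have "?u i \<in> M" using sub i by blast
      then have "inv ?g \<otimes> (?g \<otimes> x i \<otimes> inv ?g) \<otimes> ?g \<in> M"
        using i g[OF i] by (intro M.inv_op_closed1) (auto simp: conjugate_tuple_def)
      moreover have "inv ?g \<otimes> (?g \<otimes> x i \<otimes> inv ?g) \<otimes> ?g = x i"
        using g[OF i] xi by (simp add: m_assoc) (simp flip: m_assoc)
      ultimately show ?thesis by simp
    qed
    then show "B \<subseteq> M" using x by (auto simp: bij_betw_def)
  qed
  \<comment> \<open>With this and the next fact, \<open>carrier F\<close> belongs to the family that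
    is intersected; an empty family would give \<open>UNIV\<close>.\<close>
  moreover have "carrier F \<lhd> F" by (simp add: normal_self)
  moreover have "?u ` {1..r} \<subseteq> carrier F"
    using \<open>?u \<in> tuples F r\<close> by (auto simp: tuples_in)
  ultimately show ?thesis unfolding NGen_def normal_closure_def by blast
qed

section \<open>Evaluation of mixed words by ping-pong\<close>

text \<open>The ball of radius \<open>N\<close> around \<open>\<one>\<close> in the word metric of
  \<open>B\<close>.\<close>

definition short :: "nat \<Rightarrow> 'a set"
  where "short N = {word_value F v | v. v \<in> lists (B \<times> UNIV) \<and> length v \<le> N}"

lemma finite_subset_short:
  assumes "finite C" "C \<subseteq> carrier F"
  shows "\<exists>N. C \<subseteq> short N"
proof -
  let ?n = "\<lambda>c. length (normal_form c)"
  have "c \<in> short (Max (?n ` C))" if "c \<in> C" for c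
  proof -
    have "normal_form c \<in> lists (B \<times> UNIV)" "word_value F (normal_form c) = c"
      using that assms normal_form_reduced normal_form_value by (auto simp: reduced_words_def)
    moreover have "?n c \<le> Max (?n ` C)" using that assms by simp
    ultimately show ?thesis unfolding short_def by (metis (mono_tags, lifting) mem_Collect_eq)
  qed
  then show ?thesis by blast
qed

text \<open>Induction along the word from its right end; every further variable is one application
  of \<open>conjugate_maps_into_cone\<close>. The first constant \<open>c\<close> is left out, since
  the cone that it has to avoid depends on the variable before it.\<close>

lemma mixed_value_in_cone:
  assumes "(c, i, e) # ws \<in> reduced_mixed F r" "fst ` set ws \<subseteq> short N" "d \<in> short N"
  shows "sgn_pow F (conjugate_tuple N i) e \<otimes> mixed_value F ws d (conjugate_tuple N)
    \<in> cone (conjugator N i @ [(x i, e)])"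
  using assms(1,2)
proof (induction ws arbitrary: c i e)
  have move: "sgn_pow F (conjugate_tuple N i) e \<otimes> f \<in> cone (conjugator N i @ [(x i, e)])"
    if "i \<in> {1..r}" "f \<in> carrier F" "f \<notin> cone (conjugator N i @ [(x i, \<not> e)])" for i e f
    using conjugate_maps_into_cone[of "conjugator N i" "x i" f e] conjugator_reduced[of i N] that
    by (simp add: conjugate_tuple_def x_basis)
  have tup: "conjugate_tuple N \<in> tuples F r" using conjugate_tuple_NGen by (simp add: NGen_def)
  {
    case Nil
    obtain v where v: "d = word_value F v" "v \<in> lists (B \<times> UNIV)" "length v \<le> N"
      using assms(3) by (auto simp: short_def)
    \<comment> \<open>The conjugator alone has length at least \<open>N + 1\<close>, more than
      \<open>v\<close>.\<close>
    have "d \<notin> cone (conjugator N i @ [(x i, \<not> e)])"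
      unfolding v(1) by (rule short_not_in_cone) (use v in \<open>auto simp: conjugator_def\<close>)
    then show ?case
      using move[of i d e] Nil v by (simp add: reduced_mixed_Cons word_value_closed lists_closed)
  next
    case (Cons w ws)
    obtain c' i' e' where w: "w = (c', i', e')" by (cases w)
    have i: "i \<in> {1..r}" "i' \<in> {1..r}" and red: "(c', i', e') # ws \<in> reduced_mixed F r"
      and ne: "(c', i', e') \<noteq> (\<one>, i, \<not> e)"
      using Cons.prems w by (auto simp: reduced_mixed_Cons)
    let ?f = "sgn_pow F (conjugate_tuple N i') e' \<otimes> mixed_value F ws d (conjugate_tuple N)"
    have f: "?f \<in> cone (conjugator N i' @ [(x i', e')])"
      using Cons.IH[OF red] Cons.prems by simp
    obtain v where v: "c' = word_value F v" "v \<in> lists (B \<times> UNIV)" "length v \<le> N"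
      using Cons.prems w by (auto simp: short_def)
    \<comment> \<open>Otherwise \<open>c' = \<one>\<close> by
      \<open>cone_translate_disjoint\<close>, and the prefix code gives \<open>i' = i\<close> and
      \<open>e' = (\<not> e)\<close>, a pattern excluded in a reduced word.\<close>
    have "c' \<otimes> ?f \<notin> cone (conjugator N i @ [(x i, \<not> e)])"
    proof
      assume cf: "c' \<otimes> ?f \<in> cone (conjugator N i @ [(x i, \<not> e)])"
      have block: "conjugator N j @ [(x j, b)]
          = replicate N (x 1, True) @ (x 2, True) # tail_word j @ [(x j, b)]" for j b
        by (simp add: conjugator_def)
      have "x 1 \<noteq> x 2" using x_eq_iff[of 1 2] rank by simp
      from cone_translate_disjoint[OF this v(2,3) f[unfolded block] cf[unfolded block v(1)]]
      show False using tail_word_prefix_code i ne v(1) by blast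
    qed
    moreover have "c' \<otimes> ?f \<in> carrier F"
      using f red by (simp add: cone_def reduced_mixed_Cons)
    ultimately show ?case using move[of i "c' \<otimes> ?f" e] i w by simp
  }
qed

text \<open>If a variable occurs, some \<open>conjugate_tuple N\<close> gives a value other than
  \<open>\<one>\<close>. So \<open>f\<close> is constant on tuples, and a single tuple of
  \<open>NGen F r\<close> determines its value.\<close>

theorem word_map_one_on_NGen:
  assumes f: "f \<in> word_maps F r" and one: "\<And>u. u \<in> NGen F r \<Longrightarrow> f u = \<one>"
    and u: "u \<in> tuples F r"
  shows "f u = \<one>"
proof -
  obtain ws d where ws: "ws \<in> reduced_mixed F r" and d: "d \<in> carrier F"
    and eq: "\<And>u. u \<in> tuples F r \<Longrightarrow> f u = mixed_value F ws d u"
    using f by (auto simp: word_maps_def)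
  have NG: "f (conjugate_tuple N) = \<one>" "conjugate_tuple N \<in> tuples F r" for N
    using one conjugate_tuple_NGen[of N] by (auto simp: NGen_def)
  show ?thesis
  proof (cases ws)
    case Nil
    then show ?thesis using eq u NG by (metis mixed_value.simps(1))
  next
    case (Cons w ws')
    obtain c i e where w: "w = (c, i, e)" by (cases w)
    have "fst ` set ws \<subseteq> carrier F" using ws by (auto simp: reduced_mixed_def lists_eq_set)
    \<comment> \<open>One \<open>N\<close> serves all constants of the word at once,
      \<open>d\<close> included.\<close>
    then obtain N where N: "insert d (fst ` set ws) \<subseteq> short N"
      using finite_subset_short[of "insert d (fst ` set ws)"] d by auto
    then obtain v where v: "c = word_value F v" "v \<in> lists (B \<times> UNIV)" "length v \<le> N"
      using Cons w by (auto simp: short_def)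
    have "f (conjugate_tuple N) \<noteq> \<one>"
      unfolding eq[OF NG(2)] Cons w mixed_value.simps v(1)
      by (rule translate_cone_ne_one[OF v(2) _ mixed_value_in_cone])
        (use v N ws Cons w in \<open>auto simp: conjugator_def\<close>)
    then show ?thesis using NG by simp
  qed
qed

corollary word_maps_eqI:
  assumes f: "f \<in> word_maps F r" and g: "g \<in> word_maps F r"
    and eq: "\<And>u. u \<in> NGen F r \<Longrightarrow> f u = g u" and u: "u \<in> tuples F r"
  shows "f u = g u"
proof -
  have "f u \<otimes> inv (g u) = \<one>"
  proof (rule word_map_one_on_NGen[OF word_maps_mult[OF f word_maps_inv[OF g]] _ u])
    show "f u \<otimes> inv (g u) = \<one>" if "u \<in> NGen F r" for u
      using that eq word_map_closed[OF g] by (simp add: NGen_def)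
  qed
  then show ?thesis using u word_map_closed f g by (simp add: inv_solve_right')
qed

end

section \<open>The restriction map\<close>

context group
begin

section \<open>Induction principles for the two groups\<close>

lemma inv_BijGroup_eqI:
  assumes "f \<in> carrier (BijGroup S)" "g \<in> carrier (BijGroup S)" "\<And>u. u \<in> S \<Longrightarrow> g (f u) = u"
  shows "inv\<^bsub>BijGroup S\<^esub> f = g"
proof (rule group.inv_equality[OF group_BijGroup _ assms(1,2)])
  show "g \<otimes>\<^bsub>BijGroup S\<^esub> f = \<one>\<^bsub>BijGroup S\<^esub>"
    using assms by (auto simp: BijGroup_def compose_def restrict_def fun_eq_iff)
qed

text \<open>The third assumption makes the inverse of a generator again a generator, so inverses are
  covered by the case \<open>gen\<close>.\<close>

lemma generate_BijGroup_induct [consumes 3, case_names one gen mult]: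
  assumes "h \<in> generate (BijGroup S) M" "M \<subseteq> carrier (BijGroup S)"
    and "\<And>m. m \<in> M \<Longrightarrow> \<exists>m' \<in> M. \<forall>u \<in> S. m' (m u) = u"
    and "P (\<lambda>u \<in> S. u)" and "\<And>m. m \<in> M \<Longrightarrow> P m"
    and "\<And>f g. f \<in> generate (BijGroup S) M \<Longrightarrow> g \<in> generate (BijGroup S) M
      \<Longrightarrow> P f \<Longrightarrow> P g \<Longrightarrow> P (compose S f g)"
  shows "P h"
  using assms(1)
proof induction
  case one
  then show ?case using assms(4) by (simp only: BijGroup_def monoid.simps)
next
  case (incl h)
  then show ?case by (rule assms(5))
next
  case (inv h)
  then obtain m' where "m' \<in> M" "\<forall>u \<in> S. m' (h u) = u" using assms(3) by blast
  then have "inv\<^bsub>BijGroup S\<^esub> h = m'" using inv assms(2) by (intro inv_BijGroup_eqI) auto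
  then show ?case using assms(5) \<open>m' \<in> M\<close> by simp
next
  case (eng f g)
  then have "f \<in> carrier (BijGroup S)" "g \<in> carrier (BijGroup S)"
    using group.generate_in_carrier[OF group_BijGroup assms(2)] by auto
  then show ?case using eng assms(6) by (simp add: BijGroup_def)
qed

abbreviation restricted_moves :: "nat \<Rightarrow> ((nat \<Rightarrow> 'a) \<Rightarrow> nat \<Rightarrow> 'a) set"
  where "restricted_moves r \<equiv> (\<lambda>\<alpha>. restrict \<alpha> (NGen G r)) ` elementary_moves G r"

lemma carrier_GAC: "carrier (GAC r G) = generate (BijGroup (tuples G r)) (elementary_moves G r)"
  using elementary_moves_subset[of r]
  by (simp add: GAC_def carrier_subgroup_generated Int_absorb1)

lemma carrier_AC: "carrier (AC r G) = generate (BijGroup (NGen G r)) (restricted_moves r)"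
  using restricted_moves_subset[of r]
  by (simp add: AC_def carrier_subgroup_generated Int_absorb1)

lemma GAC_induct [consumes 1, case_names one gen mult]:
  assumes "\<alpha> \<in> carrier (GAC r G)"
    and "P (\<lambda>u \<in> tuples G r. u)" and "\<And>m. m \<in> elementary_moves G r \<Longrightarrow> P m"
    and "\<And>\<alpha> \<beta>. \<alpha> \<in> carrier (GAC r G) \<Longrightarrow> \<beta> \<in> carrier (GAC r G) \<Longrightarrow> P \<alpha> \<Longrightarrow> P \<beta>
      \<Longrightarrow> P (compose (tuples G r) \<alpha> \<beta>)"
  shows "P \<alpha>"
proof (rule generate_BijGroup_induct[where P = P, OF _ elementary_moves_subset _ assms(2)])
  show "\<alpha> \<in> generate (BijGroup (tuples G r)) (elementary_moves G r)"
    using assms(1) by (simp add: carrier_GAC)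
  show "\<exists>m' \<in> elementary_moves G r. \<forall>u \<in> tuples G r. m' (m u) = u"
    if "m \<in> elementary_moves G r" for m
    using move_inverse[OF that] by blast
qed (use assms(3,4) in \<open>auto simp: carrier_GAC\<close>)

lemma AC_induct [consumes 1, case_names one gen mult]:
  assumes "\<alpha> \<in> carrier (AC r G)"
    and "P (\<lambda>u \<in> NGen G r. u)"
    and "\<And>m. m \<in> elementary_moves G r \<Longrightarrow> P (restrict m (NGen G r))"
    and "\<And>\<alpha> \<beta>. \<alpha> \<in> carrier (AC r G) \<Longrightarrow> \<beta> \<in> carrier (AC r G) \<Longrightarrow> P \<alpha> \<Longrightarrow> P \<beta>
      \<Longrightarrow> P (compose (NGen G r) \<alpha> \<beta>)"
  shows "P \<alpha>"
proof (rule generate_BijGroup_induct[where P = P, OF _ restricted_moves_subset _ assms(2)])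
  show "\<alpha> \<in> generate (BijGroup (NGen G r)) (restricted_moves r)"
    using assms(1) by (simp add: carrier_AC)
  fix m assume "m \<in> restricted_moves r"
  then obtain m0 where m0: "m0 \<in> elementary_moves G r" "m = restrict m0 (NGen G r)" by blast
  then obtain m' where "m' \<in> elementary_moves G r" "\<forall>u \<in> tuples G r. m' (m0 u) = u"
    using move_inverse by blast
  then show "\<exists>m' \<in> restricted_moves r. \<forall>u \<in> NGen G r. m' (m u) = u"
    using m0 move_in_NGen[OF m0(1)] by (intro bexI[of _ "restrict m' (NGen G r)"]) (auto simp: NGen_def)
  show "P m" using m0 assms(3) by simp
qed (use assms(4) in \<open>auto simp: carrier_AC\<close>)

section \<open>The restriction homomorphism and its image\<close>

lemma GAC_in_tuples:
  assumes "\<alpha> \<in> carrier (GAC r G)" "u \<in> tuples G r"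
  shows "\<alpha> u \<in> tuples G r"
  using assms by (induction arbitrary: u rule: GAC_induct) (auto simp: compose_def dest: move_inverse)

lemma GAC_in_NGen:
  assumes "\<alpha> \<in> carrier (GAC r G)" "u \<in> NGen G r"
  shows "\<alpha> u \<in> NGen G r"
proof -
  have tuples: "u \<in> tuples G r" if "u \<in> NGen G r" for u
    using that by (simp add: NGen_def)
  show ?thesis
    using assms
    by (induction arbitrary: u rule: GAC_induct) (simp_all add: compose_def move_in_NGen tuples)
qed

lemma AC_in_Bij: "\<alpha> \<in> carrier (AC r G) \<Longrightarrow> \<alpha> \<in> Bij (NGen G r)"
  using group.generate_in_carrier[OF group_BijGroup restricted_moves_subset, of \<alpha> r]
  by (simp add: carrier_AC BijGroup_def)

lemma GAC_in_Bij: "\<alpha> \<in> carrier (GAC r G) \<Longrightarrow> \<alpha> \<in> Bij (tuples G r)"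
  using group.generate_in_carrier[OF group_BijGroup elementary_moves_subset, of \<alpha> r]
  by (simp add: carrier_GAC BijGroup_def)

lemma mult_GAC:
  assumes "\<alpha> \<in> carrier (GAC r G)" "\<beta> \<in> carrier (GAC r G)"
  shows "\<alpha> \<otimes>\<^bsub>GAC r G\<^esub> \<beta> = compose (tuples G r) \<alpha> \<beta>"
  using assms by (auto simp: GAC_def BijGroup_def dest!: GAC_in_Bij[unfolded GAC_def BijGroup_def])

lemma mult_AC:
  assumes "\<alpha> \<in> carrier (AC r G)" "\<beta> \<in> carrier (AC r G)"
  shows "\<alpha> \<otimes>\<^bsub>AC r G\<^esub> \<beta> = compose (NGen G r) \<alpha> \<beta>"
  using assms by (auto simp: AC_def BijGroup_def dest!: AC_in_Bij[unfolded AC_def BijGroup_def])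

lemma group_GAC: "group (GAC r G)" and group_AC: "group (AC r G)"
  by (simp_all add: GAC_def AC_def group.group_subgroup_generated group_BijGroup)

text \<open>\<open>\<beta>\<close> maps \<open>NGen G r\<close> into itself, so on the right-hand
  side the restricted \<open>\<alpha>\<close> is evaluated where it agrees with
  \<open>\<alpha>\<close>.\<close>

lemma restriction_compose:
  assumes "\<beta> \<in> carrier (GAC r G)"
  shows "AC_restriction r G (compose (tuples G r) \<alpha> \<beta>) =
    compose (NGen G r) (AC_restriction r G \<alpha>) (AC_restriction r G \<beta>)"
  using GAC_in_NGen[OF assms]
  by (auto simp: AC_restriction_def compose_def restrict_def fun_eq_iff NGen_def)

lemma compose_in_GAC:
  assumes "\<alpha> \<in> carrier (GAC r G)" "\<beta> \<in> carrier (GAC r G)"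
  shows "compose (tuples G r) \<alpha> \<beta> \<in> carrier (GAC r G)"
  using monoid.m_closed[OF group.is_monoid[OF group_GAC] assms] mult_GAC[OF assms] by simp

lemma compose_in_AC:
  assumes "\<alpha> \<in> carrier (AC r G)" "\<beta> \<in> carrier (AC r G)"
  shows "compose (NGen G r) \<alpha> \<beta> \<in> carrier (AC r G)"
  using monoid.m_closed[OF group.is_monoid[OF group_AC] assms] mult_AC[OF assms] by simp

lemma restriction_id: "AC_restriction r G (\<lambda>u \<in> tuples G r. u) = (\<lambda>u \<in> NGen G r. u)"
  by (auto simp: AC_restriction_def restrict_def fun_eq_iff NGen_def)

lemma restriction_in_AC:
  assumes "\<alpha> \<in> carrier (GAC r G)"
  shows "AC_restriction r G \<alpha> \<in> carrier (AC r G)"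
  using assms
proof (induction rule: GAC_induct)
  case one
  have "\<one>\<^bsub>BijGroup (NGen G r)\<^esub> \<in> carrier (AC r G)" by (simp add: carrier_AC generate.one)
  then show ?case unfolding restriction_id by (simp only: BijGroup_def monoid.simps)
next
  case (gen m)
  then show ?case unfolding carrier_AC AC_restriction_def by (intro generate.incl imageI)
next
  case (mult \<alpha> \<beta>)
  then show ?case by (simp add: restriction_compose compose_in_AC)
qed

lemma restriction_hom: "AC_restriction r G \<in> hom (GAC r G) (AC r G)"
  by (intro homI) (simp_all add: restriction_in_AC mult_GAC mult_AC restriction_compose)

text \<open>The generators of the target are restrictions of moves by definition, and restriction is
  compatible with composition.\<close>

lemma restriction_surj:
  assumes "\<gamma> \<in> carrier (AC r G)"
  shows "\<gamma> \<in> AC_restriction r G ` carrier (GAC r G)"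
  using assms
proof (induction rule: AC_induct)
  case one
  have "\<one>\<^bsub>BijGroup (tuples G r)\<^esub> \<in> carrier (GAC r G)" by (simp add: carrier_GAC generate.one)
  then have "(\<lambda>u \<in> tuples G r. u) \<in> carrier (GAC r G)" by (simp only: BijGroup_def monoid.simps)
  then show ?case unfolding restriction_id[symmetric] by (rule imageI)
next
  case (gen m)
  then show ?case unfolding carrier_GAC AC_restriction_def by (intro generate.incl imageI)
next
  case (mult \<alpha> \<beta>)
  then obtain \<alpha>' \<beta>' where "\<alpha>' \<in> carrier (GAC r G)" "\<alpha> = AC_restriction r G \<alpha>'"
    "\<beta>' \<in> carrier (GAC r G)" "\<beta> = AC_restriction r G \<beta>'" by blast
  then show ?case using compose_in_GAC restriction_compose by (metis imageI)
qed

text \<open>Quantifying over \<open>\<beta>\<close> makes the claim closed under composition, so that no substitution of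
  mixed words into mixed words is needed.\<close>

lemma GAC_preserves_word_maps:
  assumes "\<alpha> \<in> carrier (GAC r G)"
    and "\<And>u. u \<in> tuples G r \<Longrightarrow> \<beta> u \<in> tuples G r"
    and "\<And>i. i \<in> {1..r} \<Longrightarrow> (\<lambda>u. \<beta> u i) \<in> word_maps G r" and "i \<in> {1..r}"
  shows "(\<lambda>u. \<alpha> (\<beta> u) i) \<in> word_maps G r"
  using assms
proof (induction arbitrary: \<beta> i rule: GAC_induct)
  case one
  then show ?case by (intro word_maps_cong[OF one(2)]) auto
next
  case (gen m)
  note \<beta> = gen(2,3)
  have sgn: "(\<lambda>u. sgn_pow G (\<beta> u j) b) \<in> word_maps G r" if "j \<in> {1..r}" for j b
    using \<beta>(2)[OF that] word_maps_inv by (cases b) (auto simp: sgn_pow_def)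
  consider (R) k j b where "m = move_R G r k j b" "k \<in> {1..r}" "j \<in> {1..r}"
    | (L) k j b where "m = move_L G r k j b" "k \<in> {1..r}" "j \<in> {1..r}"
    | (I) k where "m = move_I G r k" "k \<in> {1..r}"
    | (C) k w where "m = move_C G r k w" "k \<in> {1..r}" "w \<in> carrier G"
    using gen(1) unfolding elementary_moves_def by blast
  \<comment> \<open>Each move overwrites a single component by a product of components, their
    inverses and constants; word maps are closed under these operations.\<close>
  then have "\<exists>k. \<exists>g \<in> word_maps G r. \<forall>u \<in> tuples G r. m (\<beta> u) = (\<beta> u)(k := g u)"
  proof cases
    case R
    show ?thesis
      by (intro exI[of _ k] bexI[OF _ word_maps_mult[OF \<beta>(2)[OF R(2)] sgn[OF R(3), of b]]])
        (simp add: R(1) move_R_def \<beta>)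
  next
    case L
    show ?thesis
      by (intro exI[of _ k] bexI[OF _ word_maps_mult[OF sgn[OF L(3), of b] \<beta>(2)[OF L(2)]]])
        (simp add: L(1) move_L_def \<beta>)
  next
    case I
    show ?thesis
      by (intro exI[of _ k] bexI[OF _ word_maps_inv[OF \<beta>(2)[OF I(2)]]])
        (simp add: I(1) move_I_def \<beta>)
  next
    case C
    show ?thesis
      by (intro exI[of _ k] bexI[OF _ word_maps_mult[OF word_maps_const_mult[OF \<beta>(2)[OF C(2)] C(3)]
              word_maps_const[OF inv_closed[OF C(3)]]]])
        (simp add: C(1) move_C_def \<beta>)
  qed
  then obtain k g where g: "g \<in> word_maps G r"
    and m: "\<And>u. u \<in> tuples G r \<Longrightarrow> m (\<beta> u) = (\<beta> u)(k := g u)" by blast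
  have "(if i = k then g else (\<lambda>u. \<beta> u i)) \<in> word_maps G r"
    using g \<beta>(2)[OF gen(4)] by simp
  then show ?case by (rule word_maps_cong) (simp add: m)
next
  case (mult \<alpha> \<gamma>)
  \<comment> \<open>The hypothesis for \<open>\<alpha>\<close> is applied with
    \<open>\<gamma> \<circ> \<beta>\<close> in place of \<open>\<beta>\<close>; the components of
    this map are word maps by the hypothesis for \<open>\<gamma>\<close>.\<close>
  have "(\<lambda>u. \<alpha> (\<gamma> (\<beta> u)) i) \<in> word_maps G r"
    using mult.IH(1)[of "\<lambda>u. \<gamma> (\<beta> u)" i] mult.IH(2)[of \<beta>] mult.prems mult.hyps GAC_in_tuples
    by blast
  then show ?case
    by (rule word_maps_cong) (simp add: compose_def mult.prems)
qed

text \<open>Take the identity for \<open>\<beta>\<close>; its components are the variables.\<close>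

lemma GAC_word_maps:
  assumes "\<alpha> \<in> carrier (GAC r G)" "i \<in> {1..r}"
  shows "(\<lambda>u. \<alpha> u i) \<in> word_maps G r"
  using GAC_preserves_word_maps[OF assms(1), of "\<lambda>u. u"] word_maps_var[of _ r True] assms(2)
  by (simp add: sgn_pow_def)

end

text \<open>The components of two elements with the same restriction are word maps that agree on
  \<open>NGen F r\<close>, hence on all tuples.\<close>

theorem (in free_group_rank) restriction_inj:
  "inj_on (AC_restriction r F) (carrier (GAC r F))"
proof (rule inj_onI)
  fix \<alpha> \<beta>
  assume \<alpha>: "\<alpha> \<in> carrier (GAC r F)" and \<beta>: "\<beta> \<in> carrier (GAC r F)"
    and eq: "AC_restriction r F \<alpha> = AC_restriction r F \<beta>"
  have NG: "\<alpha> u = \<beta> u" if "u \<in> NGen F r" for u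
    using fun_cong[OF eq, of u] that by (simp add: AC_restriction_def)
  have "\<alpha> u = \<beta> u" if u: "u \<in> tuples F r" for u
  proof (rule PiE_ext)
    show "\<alpha> u \<in> {1..r} \<rightarrow>\<^sub>E carrier F" "\<beta> u \<in> {1..r} \<rightarrow>\<^sub>E carrier F"
      using GAC_in_tuples \<alpha> \<beta> u unfolding tuples_def by blast+
    show "\<alpha> u i = \<beta> u i" if "i \<in> {1..r}" for i
      using word_maps_eqI[OF GAC_word_maps[OF \<alpha> that] GAC_word_maps[OF \<beta> that] _ u] NG by simp
  qed
  \<comment> \<open>Outside \<open>tuples F r\<close> both functions are \<open>undefined\<close>,
    being extensional.\<close>
  then show "\<alpha> = \<beta>"
    using GAC_in_Bij[OF \<alpha>] GAC_in_Bij[OF \<beta>] by (auto simp: Bij_def intro: extensionalityI)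
qed

theorem theoremA:
  fixes F :: "('a, 'm) monoid_scheme" and r :: nat
  assumes "r \<ge> 2"
    and "free_group_of_rank F r"
  shows "AC_restriction r F \<in> iso (GAC r F) (AC r F)"
proof -
  obtain B where "group F" and B: "finite B" "card B = r" "free_basis F B"
    using assms(2) by (auto simp: free_group_of_rank_def)
  interpret group F by fact
  obtain x where "bij_betw x {1..r} B"
    using B finite_same_card_bij[of "{1..r}" B] by auto
  then interpret free_group_rank F B r x
    using B assms(1) by unfold_locales
  show ?thesis
    using restriction_hom restriction_inj restriction_in_AC restriction_surj
    by (auto simp: iso_def bij_betw_def)
qed

end
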